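(* Let $b(x;u,v)=\sum_{n\ge2}\sum_{\ell=2}^{n}\sum_{m=1}^{\ell-1}b_{n,m,\ell}\,u^m v^\ell x^n$, where $b_{n,m,\ell}$ is the number of inversion sequences of length $n$ avoiding both patterns $102$ and $120$ whose largest entry is $m$ and in which the left-most occurrence of $m$ is in position $\ell$. Then $$b(x;1,1)=\frac{x^2+x^2\sqrt{1-4x}}{(x-1)\left((3x-1)\sqrt{1-4x}-4x^2+5x-1\right)}.$$ Equivalently, for all $n\ge1$, $$|\mathbf{I}_n(120,102)|=1+\sum_{i=1}^{n-1}\binom{2i}{i-1}.$$
   Context: An inversion sequence of length $n$ is an integer sequence $e=(e_1,\dots,e_n)$ with $0\le e_i\le i-1$ for all $1\le i\le n$. A word $w_1\cdots w_n$ avoids a pattern $P=p_1\cdots p_k$ if there are no $i_1<\cdots<i_k$ such that $w_{i_1}\cdots w_{i_k}$ is order isomorphic to $P$ (equal letters of $P$ corresponding to equal entries). $\mathbf{I}_n(P_1,\dots,P_r)$ denotes the set of inversion sequences of length $n$ avoiding all of the patterns $P_1,\dots,P_r$. Series are formal power series in $x$, and $\sqrt{1-4x}$ has constant term $1$. *)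

theory Defs
  imports
    Complex_Main
    "HOL-Library.Sublist"
    "HOL-Computational_Algebra.Formal_Power_Series"
begin

definition order_isomorphic :: "nat list \<Rightarrow> nat list \<Rightarrow> bool" where
  "order_isomorphic s p \<longleftrightarrow> length s = length p \<and>
     (\<forall>i<length p. \<forall>j<length p.
        (s ! i < s ! j \<longleftrightarrow> p ! i < p ! j) \<and> (s ! i = s ! j \<longleftrightarrow> p ! i = p ! j))"

definition avoids :: "nat list \<Rightarrow> nat list \<Rightarrow> bool" where
  "avoids w p \<longleftrightarrow> \<not> (\<exists>s. subseq s w \<and> order_isomorphic s p)"

(* Lists are indexed from 0, so e ! i is the entry e_{i+1} and the bound
   e_{i+1} <= (i+1) - 1 reads e ! i <= i. *)
definition inversion_sequence :: "nat \<Rightarrow> nat list \<Rightarrow> bool" where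
  "inversion_sequence n e \<longleftrightarrow> length e = n \<and> (\<forall>i<n. e ! i \<le> i)"

definition inv_avoiding :: "nat \<Rightarrow> nat list set \<Rightarrow> nat list set" where
  "inv_avoiding n Ps = {e. inversion_sequence n e \<and> (\<forall>p\<in>Ps. avoids e p)}"

(* Positions are counted from 1: pos is the least k in {1..length e} whose k-th entry is m. *)
definition leftmost_at :: "nat list \<Rightarrow> nat \<Rightarrow> nat \<Rightarrow> bool" where
  "leftmost_at e m pos \<longleftrightarrow> 1 \<le> pos \<and> pos \<le> length e \<and> e ! (pos - 1) = m \<and>
     (\<forall>k. 1 \<le> k \<and> k < pos \<longrightarrow> e ! (k - 1) \<noteq> m)"

definition b_coeff :: "nat \<Rightarrow> nat \<Rightarrow> nat \<Rightarrow> nat" where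
  "b_coeff n m l =
     card {e \<in> inv_avoiding n {[1,0,2], [1,2,0]}. Max (set e) = m \<and> leftmost_at e m l}"

(* b(x;u,v) as a formal power series in x. Every coefficient is a polynomial in u and v; these
   range over an arbitrary commutative ring (possibly a ring of indeterminates). For n < 2 the
   range of l is empty, so the series starts at n = 2. *)
definition b_gf :: "'a::comm_ring_1 \<Rightarrow> 'a \<Rightarrow> 'a fps" where
  "b_gf u v = Abs_fps (\<lambda>n. \<Sum>l=2..n. \<Sum>m=1..l-1. of_nat (b_coeff n m l) * u ^ m * v ^ l)"

(* The square root with constant term root 2 1 = 1. *)
definition sqrt_1_4x :: "real fps" where
  "sqrt_1_4x = fps_radical root 2 (1 - 4 * fps_X)"

lemma sqrt_1_4x_power2: "sqrt_1_4x ^ 2 = 1 - 4 * fps_X"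
proof -
  have "fps_radical root (Suc 1) (1 - 4 * fps_X :: real fps) ^ Suc 1 = 1 - 4 * fps_X"
    by (subst power_radical[symmetric])
      (simp_all add: fps_numeral_nth numeral_2_eq_2[symmetric])
  then show ?thesis
    by (simp add: sqrt_1_4x_def numeral_2_eq_2)
qed

lemma sqrt_1_4x_nth_0: "fps_nth sqrt_1_4x 0 = 1"
  by (simp add: sqrt_1_4x_def numeral_2_eq_2)

end

theory Submission
  imports Defs
begin

text \<open>
  An entry that is followed by both a smaller and a larger entry is the first letter of an
  occurrence of 120 or of 102, depending on which of the two comes first. So a word avoids both
  patterns iff each of its entries is a weak minimum or a weak maximum of its suffix, a condition
  that can be read off letter by letter (\<open>avoids_102_120_iff_suffix_extremal\<close>).

  Remove the first letter \<open>x\<close> of such an inversion sequence. If \<open>x\<close> is the minimum, subtracting \<open>x\<close>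
  from the rest leaves a word of the same kind, whose bounds still grow by one per position but
  start at another height. If \<open>x\<close> is the maximum, the rest is an arbitrary word of the same kind
  over \<open>{0..x}\<close>. Both cases overlap only in the constant word (\<open>card_bounded_words_Suc\<close>). It is thus
  natural to count words with bounds \<open>h, h + 1, h + 2, \<dots>\<close> for all \<open>h\<close> at once; differences in \<open>h\<close>
  turn the sums over \<open>x\<close> into two linear recurrences between power series in the length. The
  recurrence for the words over \<open>{0..h}\<close> is of first order and solved by a geometric progression.
  The one for the growing bounds has characteristic polynomial \<open>x t\<^sup>2 - t + 1\<close>, with roots
  \<open>2 / (1 + s)\<close> and \<open>2 / (1 - s)\<close> where \<open>s\<close> is the square root of \<open>1 - 4 x\<close>. Only the first root is
  a power series, and this replaces the missing second initial condition (\<open>kernel_method\<close>). With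
  a particular solution, it gives the generating function \<open>G\<close> of the avoiding inversion sequences:
  \<open>2 (1 - x) s G = 1 - 2 x + s\<close> (\<open>ramp_gf_0_closed_form\<close>).

  The numbers \<open>b\<^bsub>n,m,l\<^esub>\<close> classify all avoiding inversion sequences except the zero sequence, so
  \<open>b(x; 1, 1) = G - 1 / (1 - x)\<close>. As \<open>1 / s\<close> is the generating function of the central binomial
  coefficients, \<open>(1 - x) G\<close> has the coefficients \<open>(2 i) choose (i - 1)\<close>, shifted by one.
\<close>

section \<open>Words in which every entry is extremal among the later entries\<close>

fun suffix_extremal :: "nat list \<Rightarrow> bool" where
  "suffix_extremal [] \<longleftrightarrow> True"
| "suffix_extremal (x # w) \<longleftrightarrow>
     suffix_extremal w \<and> ((\<forall>y\<in>set w. x \<le> y) \<or> (\<forall>y\<in>set w. y \<le> x))"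

lemma length_3_conv: "length s = Suc (Suc (Suc 0)) \<longleftrightarrow> (\<exists>a b c. s = [a, b, c])"
  by (auto simp: length_Suc_conv)

lemma order_isomorphic_102:
  "order_isomorphic s [1,0,2] \<longleftrightarrow> (\<exists>a b c. s = [a, b, c] \<and> b < a \<and> a < c)"
  by (auto simp: order_isomorphic_def length_3_conv All_less_Suc numeral_2_eq_2)

lemma order_isomorphic_120:
  "order_isomorphic s [1,2,0] \<longleftrightarrow> (\<exists>a b c. s = [a, b, c] \<and> c < a \<and> a < b)"
  by (auto simp: order_isomorphic_def length_3_conv All_less_Suc numeral_2_eq_2)

text \<open>Of two later entries on either side of a given one, it does not matter which comes first: one
  order yields the pattern 102 and the other one 120.\<close>

lemma subseq_pair_cases:
  assumes "a \<in> set w" "b \<in> set w" "a \<noteq> b"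
  shows "subseq [a, b] w \<or> subseq [b, a] w"
  using assms by (induction w) (auto simp: subseq_singleton_left)

lemma subseq_Cons_Cons_iff:
  "subseq (a # u) (x # w) \<longleftrightarrow> subseq (a # u) w \<or> (a = x \<and> subseq u w)"
  by (auto simp: subseq_Cons2_iff dest: subseq_Cons')

lemma subseq_pair_in_set:
  "subseq [a, b] w \<Longrightarrow> a \<in> set w \<and> b \<in> set w"
  by (induction w) (auto simp: subseq_Cons_Cons_iff subseq_singleton_left simp del: subseq_Cons2_iff)

lemma avoids_102_120_iff_suffix_extremal:
  "avoids e [1,0,2] \<and> avoids e [1,2,0] \<longleftrightarrow> suffix_extremal e"
proof -
  have "avoids e [1,0,2] \<and> avoids e [1,2,0] \<longleftrightarrow>
      \<not> (\<exists>a b c. b < a \<and> a < c \<and> (subseq [a, b, c] e \<or> subseq [a, c, b] e))"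
    unfolding avoids_def order_isomorphic_102 order_isomorphic_120 by blast
  also have "\<dots> \<longleftrightarrow> suffix_extremal e"
  proof (induction e)
    case (Cons x w)
    have "(\<exists>a b c. b < a \<and> a < c \<and> (subseq [a, b, c] (x # w) \<or> subseq [a, c, b] (x # w))) \<longleftrightarrow>
        (\<exists>a b c. b < a \<and> a < c \<and> (subseq [a, b, c] w \<or> subseq [a, c, b] w)) \<or>
        (\<exists>b c. b < x \<and> x < c \<and> (subseq [b, c] w \<or> subseq [c, b] w))"
      unfolding subseq_Cons_Cons_iff by blast
    also have "(\<exists>b c. b < x \<and> x < c \<and> (subseq [b, c] w \<or> subseq [c, b] w)) \<longleftrightarrow>
        (\<exists>b\<in>set w. \<exists>c\<in>set w. b < x \<and> x < c)"
    proof
      assume "\<exists>b c. b < x \<and> x < c \<and> (subseq [b, c] w \<or> subseq [c, b] w)"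
      then show "\<exists>b\<in>set w. \<exists>c\<in>set w. b < x \<and> x < c"
        using subseq_pair_in_set by meson
    next
      assume "\<exists>b\<in>set w. \<exists>c\<in>set w. b < x \<and> x < c"
      then show "\<exists>b c. b < x \<and> x < c \<and> (subseq [b, c] w \<or> subseq [c, b] w)"
        using subseq_pair_cases by (metis less_trans less_irrefl)
    qed
    finally show ?case
      using Cons.IH by (auto simp: not_less)
  qed simp
  finally show ?thesis .
qed

text \<open>Inversion sequences do not survive the removal of the first letter, so the bound on each position
  is a parameter: constant bounds give all words over \<open>{0..h}\<close>, the identity gives the inversion
  sequences.\<close>

definition bounded_words :: "(nat \<Rightarrow> nat) \<Rightarrow> nat \<Rightarrow> nat list set" where
  "bounded_words \<beta> N = {w. length w = N \<and> suffix_extremal w \<and> (\<forall>i<N. w ! i \<le> \<beta> i)}"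

lemma inv_avoiding_eq_bounded_words:
  "inv_avoiding n {[1,0,2], [1,2,0]} = bounded_words (\<lambda>i. i) n"
  using avoids_102_120_iff_suffix_extremal
  by (auto simp: inv_avoiding_def inversion_sequence_def bounded_words_def)

lemma finite_bounded_words: "finite (bounded_words \<beta> N)"
proof (rule finite_subset)
  show "bounded_words \<beta> N \<subseteq> {w. set w \<subseteq> {..(\<Sum>i<N. \<beta> i)} \<and> length w = N}"
  proof (clarsimp simp: bounded_words_def in_set_conv_nth)
    fix w i assume "\<forall>i<length w. w ! i \<le> \<beta> i" "i < length w"
    then show "w ! i \<le> (\<Sum>i<length w. \<beta> i)"
      by (meson le_trans member_le_sum finite_lessThan lessThan_iff zero_le)
  qed
qed (simp add: finite_lists_length_eq)

lemma bounded_words_0 [simp]: "bounded_words \<beta> 0 = {[]}"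
  by (auto simp: bounded_words_def)

lemma suffix_extremal_map_add [simp]:
  "suffix_extremal (map (\<lambda>y. y + x) w) \<longleftrightarrow> suffix_extremal w"
  by (induction w) auto

lemma suffix_extremal_replicate [simp]: "suffix_extremal (replicate N x)"
  by (induction N) auto

lemma bij_betw_bounded_words_above:
  assumes "\<And>i. x \<le> \<beta> i"
  shows "bij_betw (map (\<lambda>y. y + x)) (bounded_words (\<lambda>i. \<beta> i - x) N)
           {w \<in> bounded_words \<beta> N. \<forall>y\<in>set w. x \<le> y}"
proof (rule bij_betwI[where g = "map (\<lambda>y. y - x)"])
  show "map (\<lambda>y. y + x) \<in> bounded_words (\<lambda>i. \<beta> i - x) N \<rightarrow>
          {w \<in> bounded_words \<beta> N. \<forall>y\<in>set w. x \<le> y}"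
    using assms by (auto simp: bounded_words_def le_diff_conv2)
  have inv: "map (\<lambda>y. y + x) (map (\<lambda>y. y - x) w) = w" if "\<forall>y\<in>set w. x \<le> y" for w
    using that by (simp add: map_idI)
  show "map (\<lambda>y. y - x) \<in> {w \<in> bounded_words \<beta> N. \<forall>y\<in>set w. x \<le> y} \<rightarrow>
          bounded_words (\<lambda>i. \<beta> i - x) N"
  proof
    fix w assume w: "w \<in> {w \<in> bounded_words \<beta> N. \<forall>y\<in>set w. x \<le> y}"
    then have "suffix_extremal (map (\<lambda>y. y - x) w)"
      using inv[of w] suffix_extremal_map_add[of x "map (\<lambda>y. y - x) w"]
      by (auto simp: bounded_words_def simp del: suffix_extremal_map_add)
    then show "map (\<lambda>y. y - x) w \<in> bounded_words (\<lambda>i. \<beta> i - x) N"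
      using w by (auto simp: bounded_words_def intro: diff_le_mono)
  qed
  show "map (\<lambda>y. y + x) (map (\<lambda>y. y - x) w) = w"
    if "w \<in> {w \<in> bounded_words \<beta> N. \<forall>y\<in>set w. x \<le> y}" for w
    using inv that by blast
qed (simp add: o_def)

text \<open>The first letter \<open>x\<close> is a minimum or a maximum of the rest. In the first case the rest is
  shifted down by \<open>x\<close>. In the second case all its entries are at most \<open>x\<close>, and since \<open>\<beta>\<close>
  increases from \<open>\<beta> 0 \<ge> x\<close>, this bound implies all the old ones. Both cases hold
  exactly when every letter of the rest is \<open>x\<close>, which explains the term \<open>- 1\<close>.\<close>

lemma card_bounded_words_Suc:
  assumes "mono \<beta>"
  shows "real (card (bounded_words \<beta> (Suc N))) =
    (\<Sum>x\<le>\<beta> 0. real (card (bounded_words (\<lambda>i. \<beta> (Suc i) - x) N)) +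
                real (card (bounded_words (\<lambda>_. x) N)) - 1)"
proof -
  define R where "R x = {w \<in> bounded_words (\<lambda>i. \<beta> (Suc i)) N.
      (\<forall>y\<in>set w. x \<le> y) \<or> (\<forall>y\<in>set w. y \<le> x)}" for x
  have fin: "finite (R x)" for x
    unfolding R_def using finite_bounded_words by simp
  have "bounded_words \<beta> (Suc N) = (\<Union>x\<le>\<beta> 0. (#) x ` R x)"
    by (auto simp: bounded_words_def R_def All_less_Suc2 length_Suc_conv)
  also have "card \<dots> = (\<Sum>x\<le>\<beta> 0. card ((#) x ` R x))"
    using fin by (intro card_UN_disjoint) auto
  also have "\<dots> = (\<Sum>x\<le>\<beta> 0. card (R x))"
    by (simp add: card_image)
  finally have "real (card (bounded_words \<beta> (Suc N))) = (\<Sum>x\<le>\<beta> 0. real (card (R x)))"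
    by simp
  also have "\<dots> = (\<Sum>x\<le>\<beta> 0. real (card (bounded_words (\<lambda>i. \<beta> (Suc i) - x) N)) +
                real (card (bounded_words (\<lambda>_. x) N)) - 1)"
  proof (rule sum.cong[OF refl])
    fix x assume "x \<in> {..\<beta> 0}"
    then have le: "x \<le> \<beta> i" for i
      using monoD[OF assms, of 0 i] by simp
    define A where "A = {w \<in> bounded_words (\<lambda>i. \<beta> (Suc i)) N. \<forall>y\<in>set w. x \<le> y}"
    define B where "B = bounded_words (\<lambda>_. x) N"
    have "B = {w \<in> bounded_words (\<lambda>i. \<beta> (Suc i)) N. \<forall>y\<in>set w. y \<le> x}"
      unfolding B_def bounded_words_def using le
      by (auto simp: all_set_conv_all_nth intro: order_trans)
    then have R: "R x = A \<union> B"
      by (auto simp: R_def A_def)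
    have "w = replicate N x" if "w \<in> A \<inter> B" for w
    proof -
      have "length w = N" "\<forall>y\<in>set w. x \<le> y" "\<forall>y\<in>set w. y \<le> x"
        using that by (auto simp: A_def B_def bounded_words_def all_set_conv_all_nth)
      then show ?thesis
        by (metis antisym replicate_length_same)
    qed
    moreover have "replicate N x \<in> A \<inter> B"
      using le by (auto simp: A_def B_def bounded_words_def)
    ultimately have "A \<inter> B = {replicate N x}"
      by blast
    moreover have "card A = card (bounded_words (\<lambda>i. \<beta> (Suc i) - x) N)"
      unfolding A_def by (rule bij_betw_same_card[OF bij_betw_bounded_words_above, symmetric]) (rule le)
    moreover have "finite A" "finite B"
      by (auto simp: A_def B_def finite_bounded_words)
    ultimately show "real (card (R x)) =
        real (card (bounded_words (\<lambda>i. \<beta> (Suc i) - x) N)) +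
        real (card (bounded_words (\<lambda>_. x) N)) - 1"
      using card_Un_Int[of A B] unfolding R B_def by simp
  qed
  finally show ?thesis .
qed

section \<open>Recurrences in the height of the bound\<close>

text \<open>Power series in the word length, for bounds that stay at height \<open>h\<close> and for bounds that start
  at height \<open>h\<close> and rise by one per position. The inversion sequences are the case \<open>h = 0\<close> of the
  latter.\<close>

definition flat_gf :: "nat \<Rightarrow> real fps" where
  "flat_gf h = Abs_fps (\<lambda>N. real (card (bounded_words (\<lambda>_. h) N)))"

definition ramp_gf :: "nat \<Rightarrow> real fps" where
  "ramp_gf h = Abs_fps (\<lambda>N. real (card (bounded_words (\<lambda>i. h + i) N)))"

lemma flat_gf_nth_Suc:
  "fps_nth (flat_gf h) (Suc N) = (\<Sum>x\<le>h. 2 * fps_nth (flat_gf x) N - 1)"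
proof -
  have "fps_nth (flat_gf h) (Suc N) =
      (\<Sum>x\<le>h. fps_nth (flat_gf (h - x)) N + fps_nth (flat_gf x) N - 1)"
    by (simp add: flat_gf_def card_bounded_words_Suc monoI)
  also have "\<dots> = (\<Sum>x\<le>h. fps_nth (flat_gf (h - x)) N) + (\<Sum>x\<le>h. fps_nth (flat_gf x) N - 1)"
    by (simp add: sum.distrib sum_subtractf)
  also have "(\<Sum>x\<le>h. fps_nth (flat_gf (h - x)) N) = (\<Sum>x\<le>h. fps_nth (flat_gf x) N)"
    using sum.nat_diff_reindex[of "\<lambda>x. fps_nth (flat_gf x) N" "Suc h"]
    by (simp add: lessThan_Suc_atMost)
  finally show ?thesis
    by (simp add: sum.distrib sum_subtractf sum_distrib_left)
qed

lemma ramp_gf_nth_Suc: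
  "fps_nth (ramp_gf h) (Suc N) =
    (\<Sum>x\<le>h. fps_nth (ramp_gf (Suc x)) N + fps_nth (flat_gf x) N - 1)"
proof -
  have "fps_nth (ramp_gf h) (Suc N) =
      (\<Sum>x\<le>h. fps_nth (ramp_gf (Suc (h - x))) N + fps_nth (flat_gf x) N - 1)"
  proof -
    have "(\<lambda>i. h + Suc i - x) = (\<lambda>i. Suc (h - x) + i)" if "x \<le> h" for x
      using that by (auto simp: fun_eq_iff)
    moreover have "mono (\<lambda>i. h + i)"
      by (simp add: monoI)
    ultimately show ?thesis
      unfolding ramp_gf_def flat_gf_def fps_nth_Abs_fps
      by (subst card_bounded_words_Suc) (auto intro!: sum.cong simp del: add_Suc add_Suc_right)
  qed
  also have "\<dots> = (\<Sum>x\<le>h. fps_nth (ramp_gf (Suc (h - x))) N) + (\<Sum>x\<le>h. fps_nth (flat_gf x) N - 1)"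
    by (simp add: sum.distrib sum_subtractf)
  also have "(\<Sum>x\<le>h. fps_nth (ramp_gf (Suc (h - x))) N) = (\<Sum>x\<le>h. fps_nth (ramp_gf (Suc x)) N)"
    using sum.nat_diff_reindex[of "\<lambda>x. fps_nth (ramp_gf (Suc x)) N" "Suc h"]
    by (simp add: lessThan_Suc_atMost)
  finally show ?thesis
    by (simp add: sum.distrib sum_subtractf)
qed

lemma flat_gf_nth_0 [simp]: "fps_nth (flat_gf h) 0 = 1"
  by (simp add: flat_gf_def)

lemma ramp_gf_nth_0 [simp]: "fps_nth (ramp_gf h) 0 = 1"
  by (simp add: ramp_gf_def)

abbreviation geometric :: "real fps" where
  "geometric \<equiv> Abs_fps (\<lambda>_. 1)"

lemma geometric_mult: "(1 - fps_X) * geometric = 1"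
  by (rule fps_ext) (simp add: algebra_simps fps_X_mult_nth)

lemma flat_gf_0: "flat_gf 0 = geometric"
proof (rule fps_ext)
  fix n show "fps_nth (flat_gf 0) n = fps_nth geometric n"
    by (induction n) (auto simp: flat_gf_nth_Suc)
qed

text \<open>The sum over the first letter in \<open>flat_gf_nth_Suc\<close> telescopes when the heights \<open>h\<close> and \<open>Suc h\<close>
  are compared; the same happens in \<open>ramp_gf_Suc\<close> below.\<close>

lemma flat_gf_Suc:
  "flat_gf (Suc h) = flat_gf h + fps_X * (2 * flat_gf (Suc h) - geometric)"
proof (rule fps_ext)
  fix n
  show "fps_nth (flat_gf (Suc h)) n =
      fps_nth (flat_gf h + fps_X * (2 * flat_gf (Suc h) - geometric)) n"
    by (cases n) (auto simp: flat_gf_nth_Suc fps_numeral_fps_const)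
qed

lemma ramp_gf_0: "ramp_gf 0 = 1 + fps_X * ramp_gf 1"
proof (rule fps_ext)
  fix n show "fps_nth (ramp_gf 0) n = fps_nth (1 + fps_X * ramp_gf 1) n"
    by (cases n) (auto simp: ramp_gf_nth_Suc flat_gf_0)
qed

lemma ramp_gf_Suc:
  "ramp_gf (Suc h) =
    ramp_gf h + fps_X * ramp_gf (Suc (Suc h)) + fps_X * (flat_gf (Suc h) - geometric)"
proof (rule fps_ext)
  fix n
  show "fps_nth (ramp_gf (Suc h)) n =
    fps_nth (ramp_gf h + fps_X * ramp_gf (Suc (Suc h)) + fps_X * (flat_gf (Suc h) - geometric)) n"
    by (cases n) (auto simp: ramp_gf_nth_Suc)
qed

section \<open>Solving the recurrences by the kernel method\<close>

text \<open>A sequence satisfying this recurrence is a combination of powers of \<open>2 / (1 + s)\<close> and of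
  \<open>2 / (1 - s)\<close>, where \<open>s\<close> is \<open>sqrt_1_4x\<close>. The quantity \<open>Q h\<close> in the proof cancels the first part
  and so is multiplied by \<open>2 / (1 - s)\<close> in each step. Since \<open>1 - s\<close> has no constant term, \<open>Q 0\<close> is
  then divisible by every power of \<open>x\<close>, hence zero.\<close>

lemma kernel_method:
  fixes M :: "nat \<Rightarrow> real fps"
  assumes rec: "\<And>h. M (Suc h) = M h + fps_X * M (Suc (Suc h))"
  shows "2 * M 0 = (1 + sqrt_1_4x) * M 1"
proof -
  define Q where "Q h = (1 + sqrt_1_4x) * M (Suc h) - 2 * M h" for h
  have Q_step: "2 * Q h = (1 - sqrt_1_4x) * Q (Suc h)" for h
  proof -
    have "2 * Q h - (1 - sqrt_1_4x) * Q (Suc h) =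
        4 * (M (Suc h) - M h) - (1 - sqrt_1_4x ^ 2) * M (Suc (Suc h))"
      by (simp add: Q_def algebra_simps power2_eq_square)
    also have "\<dots> = 0"
      by (simp add: rec[of h] sqrt_1_4x_power2 algebra_simps)
    finally show ?thesis by simp
  qed
  have Q_power: "2 ^ k * Q 0 = (1 - sqrt_1_4x) ^ k * Q k" for k
  proof (induction k)
    case (Suc k)
    have "2 ^ Suc k * Q 0 = 2 * (2 ^ k * Q 0)"
      by (simp add: mult_ac)
    also have "\<dots> = (1 - sqrt_1_4x) ^ k * (2 * Q k)"
      unfolding Suc by (simp add: mult_ac)
    finally show ?case
      unfolding Q_step by (simp add: mult_ac)
  qed simp
  have "fps_nth (Q 0) n = 0" for n
  proof -
    have "fps_nth ((1 - sqrt_1_4x) ^ Suc n * Q (Suc n)) n = 0"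
      by (simp only: fps_mult_nth, rule sum.neutral)
         (auto intro!: startsby_zero_power_prefix[rule_format] simp del: power_Suc simp: sqrt_1_4x_nth_0)
    then have "fps_nth (fps_const (2 ^ Suc n) * Q 0) n = 0"
      using Q_power[of "Suc n"]
      by (metis fps_const_power fps_numeral_fps_const)
    then show ?thesis by simp
  qed
  then have "Q 0 = 0" by (intro fps_ext) simp
  then show ?thesis by (simp add: Q_def)
qed

text \<open>The fixed point of the recurrence \<open>flat_gf_Suc\<close> is \<open>1 / (2 (1 - x))\<close>, and the deviation from it is
  multiplied by \<open>\<rho> = 1 / (1 - 2 x)\<close> in each step.\<close>

lemma flat_gf_closed_form:
  assumes \<rho>: "\<rho> * (1 - 2 * fps_X) = 1"
  shows "2 * (1 - fps_X) * flat_gf h = 1 + \<rho> ^ h"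
proof (induction h)
  case 0
  then show ?case using geometric_mult by (simp only: flat_gf_0 mult.assoc) simp
next
  case (Suc h)
  have "(1 - 2 * fps_X) * flat_gf (Suc h) = flat_gf h - fps_X * geometric"
    using flat_gf_Suc[of h] by (simp add: algebra_simps)
  then have "(1 - 2 * fps_X) * (2 * (1 - fps_X) * flat_gf (Suc h)) =
      2 * (1 - fps_X) * flat_gf h - 2 * fps_X * ((1 - fps_X) * geometric)"
    by algebra
  then have *: "(1 - 2 * fps_X) * (2 * (1 - fps_X) * flat_gf (Suc h)) = 1 + \<rho> ^ h - 2 * fps_X"
    by (simp only: Suc geometric_mult mult_1_right)
  have "2 * (1 - fps_X) * flat_gf (Suc h) =
      \<rho> * ((1 - 2 * fps_X) * (2 * (1 - fps_X) * flat_gf (Suc h)))"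
    using \<rho> by (simp only: mult.assoc[symmetric] mult_1_left)
  also have "\<dots> = \<rho> * (1 - 2 * fps_X) + \<rho> ^ Suc h"
    unfolding * by (simp add: algebra_simps)
  finally show ?case
    by (simp only: \<rho>)
qed

text \<open>The source term of \<open>ramp_gf_Suc\<close> is a constant plus a multiple of \<open>\<rho> ^ h\<close>, so a particular
  solution of the same form exists. Its difference to \<open>ramp_gf\<close> satisfies the hypothesis of
  \<open>kernel_method\<close>, whose conclusion, together with \<open>ramp_gf_0\<close>, is a pair of linear equations for
  \<open>ramp_gf 0\<close> and \<open>ramp_gf 1\<close>.\<close>

lemma ramp_gf_0_closed_form:
  "2 * (1 - fps_X) * sqrt_1_4x * ramp_gf 0 = 1 - 2 * fps_X + sqrt_1_4x"
proof -
  let ?X = "fps_X :: real fps" and ?s = sqrt_1_4x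
  define \<rho> :: "real fps" where "\<rho> = inverse (1 - 2 * fps_X)"
  define \<alpha> :: "real fps" where "\<alpha> = (1 - 2 * fps_X) * inverse (1 - 4 * fps_X)"
  have \<rho>: "\<rho> * (1 - 2 * ?X) = 1"
    unfolding \<rho>_def by (rule inverse_mult_eq_1) (simp add: fps_numeral_fps_const)
  have inv4: "inverse (1 - 4 * ?X) * (1 - 4 * ?X) = 1"
    by (rule inverse_mult_eq_1) (simp add: fps_numeral_fps_const)
  have \<alpha>: "\<alpha> * (1 - 4 * ?X) = 1 - 2 * ?X"
    unfolding \<alpha>_def using inv4 by (simp add: mult.assoc)
  have \<alpha>\<rho>: "\<alpha> * \<rho> * (1 - 4 * ?X) = 1"
    using \<alpha> \<rho> by algebra
  have \<alpha>2: "\<alpha> * (2 - \<rho>) = 1"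
    using \<alpha>\<rho> \<rho> by algebra
  \<comment> \<open>The particular solution is \<open>(\<alpha> \<rho>\<^sup>h + 1) / (2 (1 - x))\<close>, and \<open>M\<close> is the homogeneous
    remainder, cleared of denominators. The coefficient \<open>\<alpha> = 1 / (2 - \<rho>)\<close> comes from inserting
    \<open>\<rho>\<^sup>h\<close> into the recurrence.\<close>
  define M where "M h = 2 * (1 - ?X) * ramp_gf h - \<alpha> * \<rho> ^ h - 1" for h
  have "M (Suc h) = M h + ?X * M (Suc (Suc h))" for h
  proof -
    define p where "p = \<rho> ^ h"
    have "2 * (1 - ?X) * flat_gf (Suc h) = 1 + \<rho> * p"
      using flat_gf_closed_form[OF \<rho>, of "Suc h"] by (simp add: p_def)
    then show ?thesis
      using ramp_gf_Suc[of h] geometric_mult \<alpha>2 \<rho>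
      unfolding M_def power_Suc p_def[symmetric] by algebra
  qed
  then have "2 * M 0 = (1 + ?s) * M 1"
    by (rule kernel_method)
  \<comment> \<open>Eliminating \<open>ramp_gf 1\<close> leaves this nonzero common factor.\<close>
  then have "(1 + ?s)^2 * (2 * ?s) * (2 * (1 - ?X) * ?s * ramp_gf 0) =
             (1 + ?s)^2 * (2 * ?s) * (1 - 2 * ?X + ?s)"
    using ramp_gf_0 \<alpha> \<alpha>\<rho> sqrt_1_4x_power2
    unfolding M_def power_0 power_one_right by algebra
  moreover have "(1 + ?s)^2 * (2 * ?s) \<noteq> 0"
  proof -
    have "fps_nth (1 + ?s) 0 \<noteq> 0" "fps_nth ?s 0 \<noteq> 0"
      by (simp_all add: sqrt_1_4x_nth_0)
    then have "1 + ?s \<noteq> 0" "?s \<noteq> 0"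
      by (metis fps_zero_nth)+
    then show ?thesis by simp
  qed
  ultimately show ?thesis
    using mult_left_cancel by blast
qed

section \<open>Central binomial coefficients\<close>

definition central_binomial_gf :: "real fps" where
  "central_binomial_gf = Abs_fps (\<lambda>n. real ((2 * n) choose n))"

lemma central_binomial_Suc:
  "real (Suc n) * real ((2 * Suc n) choose Suc n) = 2 * (2 * real n + 1) * real ((2 * n) choose n)"
proof -
  have 1: "Suc n * ((2 * Suc n) choose Suc n) = 2 * Suc n * (Suc (2 * n) choose n)"
    using Suc_times_binomial_eq[of "Suc (2*n)" n] by simp
  have 2: "Suc n * (Suc (2 * n) choose n) = Suc (2 * n) * ((2 * n) choose n)"
    using binomial_absorb_comp[of "Suc (2 * n)" n] by simp
  have "Suc n * ((2 * Suc n) choose Suc n) = 2 * (Suc (2 * n) * ((2 * n) choose n))"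
    unfolding 2[symmetric] using 1 by (simp only: mult.assoc)
  then have "real (Suc n) * real ((2 * Suc n) choose Suc n) =
      2 * (real (Suc (2 * n)) * real ((2 * n) choose n))"
    by (simp only: of_nat_eq_iff of_nat_numeral flip: of_nat_mult)
  then show ?thesis by simp
qed

text \<open>The recurrence for the central binomial coefficients is the differential equation
  \<open>(1 - 4 x) B' = 2 B\<close>, which makes the derivative of \<open>(1 - 4 x) B\<^sup>2\<close> vanish. So
  \<open>(s B)\<^sup>2 = 1\<close>, and the constant term excludes \<open>s B = - 1\<close>.\<close>

lemma sqrt_1_4x_mult_central_binomial_gf: "sqrt_1_4x * central_binomial_gf = 1"
proof -
  let ?B = central_binomial_gf and ?X = "fps_X :: real fps"
  have ode: "(1 - 4 * ?X) * fps_deriv ?B = 2 * ?B"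
  proof (rule fps_ext)
    fix n show "fps_nth ((1 - 4 * ?X) * fps_deriv ?B) n = fps_nth (2 * ?B) n"
      using central_binomial_Suc[of n]
      by (cases n) (simp_all add: central_binomial_gf_def algebra_simps fps_numeral_fps_const
                             del: binomial_Suc_Suc)
  qed
  have "fps_deriv ((1 - 4 * ?X) * ?B ^ 2) = 0"
  proof -
    have "fps_deriv ((1 - 4 * ?X) * ?B ^ 2) =
        2 * ?B * ((1 - 4 * ?X) * fps_deriv ?B) - 4 * ?B ^ 2"
      by (simp add: power2_eq_square algebra_simps)
    then show ?thesis unfolding ode by (simp add: power2_eq_square)
  qed
  then have "(1 - 4 * ?X) * ?B ^ 2 = fps_const (fps_nth ((1 - 4 * ?X) * ?B ^ 2) 0)"
    by (simp only: fps_deriv_eq_0_iff)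
  also have "\<dots> = 1"
    by (simp add: central_binomial_gf_def fps_numeral_fps_const power2_eq_square)
  finally have "(sqrt_1_4x * ?B) ^ 2 = 1"
    by (simp add: power_mult_distrib sqrt_1_4x_power2)
  moreover have "sqrt_1_4x * ?B \<noteq> - 1"
  proof
    assume "sqrt_1_4x * ?B = - 1"
    then have "fps_nth (sqrt_1_4x * ?B) 0 = fps_nth (- 1) 0" by simp
    then show False by (simp add: central_binomial_gf_def sqrt_1_4x_nth_0)
  qed
  ultimately show ?thesis
    by (simp add: power2_eq_1_iff)
qed

text \<open>The conditional is needed at \<open>i = 0\<close>, where truncated subtraction would give
  \<open>0 choose 0 = 1\<close> in place of 0.\<close>

definition shifted_binomial_gf :: "real fps" where
  "shifted_binomial_gf = Abs_fps (\<lambda>i. if i = 0 then 0 else real ((2 * i) choose (i - 1)))"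

lemma central_binomial_split:
  "real ((2 * Suc i) choose Suc i) =
     2 * (real ((2 * i) choose i) + (if i = 0 then 0 else real ((2 * i) choose (i - 1))))"
proof (cases i)
  case (Suc j)
  have "(2 * Suc i) choose Suc i = (Suc (2 * i) choose i) + (Suc (2 * i) choose Suc i)"
    by simp
  moreover have "Suc (2 * i) choose Suc i = Suc (2 * i) choose i"
    by (subst binomial_symmetric) auto
  moreover have "Suc (2 * i) choose i = ((2 * i) choose j) + ((2 * i) choose i)"
    using Suc by simp
  ultimately show ?thesis using Suc by simp
qed simp

lemma central_binomial_gf_eq:
  "central_binomial_gf = 1 + 2 * fps_X * (central_binomial_gf + shifted_binomial_gf)"
proof (rule fps_ext)
  fix n
  show "fps_nth central_binomial_gf n =
      fps_nth (1 + 2 * fps_X * (central_binomial_gf + shifted_binomial_gf)) n"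
    using central_binomial_split[of "n - 1"]
    by (cases n)
       (simp_all add: central_binomial_gf_def shifted_binomial_gf_def mult.assoc
          fps_numeral_fps_const del: binomial_Suc_Suc mult_Suc_right)
qed

lemma ramp_gf_0_binomial:
  "ramp_gf 0 = geometric * (1 + fps_X * shifted_binomial_gf)"
proof -
  let ?X = "fps_X :: real fps" and ?s = sqrt_1_4x
  have "2 * ?s * ((1 - ?X) * ramp_gf 0) = 2 * ?s * (1 + ?X * shifted_binomial_gf)"
    using ramp_gf_0_closed_form sqrt_1_4x_mult_central_binomial_gf central_binomial_gf_eq
    by algebra
  moreover have "2 * ?s \<noteq> 0"
    using sqrt_1_4x_nth_0 by auto
  ultimately have "(1 - ?X) * ramp_gf 0 = 1 + ?X * shifted_binomial_gf"
    using mult_left_cancel by blast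
  then show ?thesis using geometric_mult by algebra
qed

section \<open>Counting by largest entry and its left-most position\<close>

lemma leftmost_at_unique:
  assumes "leftmost_at e m l" "leftmost_at e m l'"
  shows "l = l'"
  using assms unfolding leftmost_at_def by (metis linorder_neqE_nat)

lemma leftmost_at_exists:
  assumes "m \<in> set e"
  shows "\<exists>l. leftmost_at e m l"
proof -
  define k where "k = (LEAST k. k < length e \<and> e ! k = m)"
  have "\<exists>k. k < length e \<and> e ! k = m"
    using assms by (auto simp: in_set_conv_nth)
  then have k: "k < length e \<and> e ! k = m"
    unfolding k_def by (rule LeastI_ex)
  have "e ! j \<noteq> m" if "j < k" for j
    using not_less_Least[of j "\<lambda>k. k < length e \<and> e ! k = m"] that k unfolding k_def by auto
  then have "leftmost_at e m (Suc k)"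
    using k by (auto simp: leftmost_at_def)
  then show ?thesis ..
qed

text \<open>The ranges of \<open>l\<close> and \<open>m\<close> omit nothing but the zero sequence: if the largest entry \<open>m\<close> is
  positive and first occurs at position \<open>l\<close>, then \<open>1 \<le> m \<le> l - 1\<close> by the bound on that entry.\<close>

lemma sum_b_coeff:
  "1 + (\<Sum>l=2..n. \<Sum>m=1..l-1. b_coeff n m l) = card (inv_avoiding n {[1,0,2], [1,2,0]})"
proof (cases "n = 0")
  case True
  then show ?thesis
    using inv_avoiding_eq_bounded_words[of 0] by (simp del: One_nat_def)
next
  case False
  define I where "I = inv_avoiding n {[1,0,2], [1,2,0]}"
  define S where "S = I - {replicate n 0}"
  define T where "T = (SIGMA l:{2..n}. {1..l-1})"
  define g where "g e = (THE l. leftmost_at e (Max (set e)) l, Max (set e))" for e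
  have fin: "finite I"
    unfolding I_def inv_avoiding_eq_bounded_words by (rule finite_bounded_words)
  have zero: "replicate n 0 \<in> I"
    unfolding I_def inv_avoiding_eq_bounded_words by (auto simp: bounded_words_def)
  have len: "length e = n" and bound: "\<And>i. i < n \<Longrightarrow> e ! i \<le> i" if "e \<in> I" for e
    using that by (auto simp: I_def inv_avoiding_def inversion_sequence_def)
  have leftmost_g: "leftmost_at e (Max (set e)) (fst (g e))" if "e \<in> I" for e
  proof -
    have "Max (set e) \<in> set e" using len[OF that] False by (intro Max_in) auto
    then have "\<exists>!l. leftmost_at e (Max (set e)) l"
      using leftmost_at_exists leftmost_at_unique by blast
    then show ?thesis unfolding g_def fst_conv by (rule theI')
  qed
  have g_eq: "g e = (l, m) \<longleftrightarrow> Max (set e) = m \<and> leftmost_at e m l" if "e \<in> I" for e l m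
    using leftmost_g[OF that] leftmost_at_unique by (auto simp: g_def)
  have maps: "g ` S \<subseteq> T"
  proof
    fix t assume "t \<in> g ` S"
    then obtain e where e: "e \<in> I" "e \<noteq> replicate n 0" "t = g e" by (auto simp: S_def)
    obtain l m where lm: "g e = (l, m)" by fastforce
    have m: "Max (set e) = m" and l: "leftmost_at e m l"
      using g_eq[OF e(1), THEN iffD1, OF lm] by blast+
    have "m \<noteq> 0"
    proof
      assume "m = 0"
      then have "\<forall>y\<in>set e. y = 0" using m Max_ge[of "set e"] by (metis finite_set le_zero_eq)
      then have "e = replicate n 0"
        using len[OF e(1)] by (metis replicate_length_same)
      then show False using e(2) by simp
    qed
    moreover have "m \<le> l - 1" "l \<le> n"
      using l bound[OF e(1), of "l - 1"] len[OF e(1)] by (auto simp: leftmost_at_def)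
    ultimately show "t \<in> T"
      unfolding T_def e(3) lm by simp
  qed
  have fibre: "b_coeff n m l = card {e \<in> S. g e = (l, m)}" if "(l, m) \<in> T" for l m
  proof -
    have "{e \<in> I. Max (set e) = m \<and> leftmost_at e m l} = {e \<in> S. g e = (l, m)}"
      using that False by (auto simp: S_def g_eq T_def)
    then show ?thesis unfolding b_coeff_def I_def by simp
  qed
  have "(\<Sum>l=2..n. \<Sum>m=1..l-1. b_coeff n m l) = (\<Sum>(l, m)\<in>T. b_coeff n m l)"
    unfolding T_def by (rule sum.Sigma) auto
  also have "\<dots> = (\<Sum>t\<in>T. \<Sum>e\<in>{e \<in> S. g e = t}. 1)"
    by (intro sum.cong refl) (auto simp: fibre)
  also have "\<dots> = card S"
    using sum.group[of S T g "\<lambda>_. 1::nat"] fin maps by (simp add: S_def T_def)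
  finally show ?thesis
    using zero fin unfolding S_def I_def[symmetric]
    by (simp add: card_gt_0_iff) (metis Suc_pred card_gt_0_iff empty_iff)
qed

lemma b_gf_eq: "(b_gf 1 1 :: real fps) = ramp_gf 0 - geometric"
proof (rule fps_ext)
  fix n
  have "fps_nth (ramp_gf 0) n = real (card (inv_avoiding n {[1,0,2], [1,2,0]}))"
    unfolding inv_avoiding_eq_bounded_words by (simp add: ramp_gf_def)
  then show "fps_nth (b_gf 1 1 :: real fps) n = fps_nth (ramp_gf 0 - geometric) n"
    unfolding sum_b_coeff[symmetric] by (simp add: b_gf_def)
qed

theorem theorem4p10:
  shows "(b_gf 1 1 :: real fps) =
      (fps_X ^ 2 + fps_X ^ 2 * sqrt_1_4x) /
      ((fps_X - 1) * ((3 * fps_X - 1) * sqrt_1_4x - 4 * fps_X ^ 2 + 5 * fps_X - 1))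
    \<and> (\<forall>n\<ge>1. card (inv_avoiding n {[1,2,0], [1,0,2]}) =
          1 + (\<Sum>i=1..n-1. (2 * i) choose (i - 1)))"
proof
  let ?X = "fps_X :: real fps" and ?s = sqrt_1_4x
  let ?d = "(?X - 1) * ((3 * ?X - 1) * ?s - 4 * ?X ^ 2 + 5 * ?X - 1)"
  have "2 * (b_gf 1 1 * ?d) = 2 * (?X ^ 2 + ?X ^ 2 * ?s)"
    using ramp_gf_0_closed_form geometric_mult sqrt_1_4x_power2
    unfolding b_gf_eq by algebra
  then have "b_gf 1 1 * ?d = ?X ^ 2 + ?X ^ 2 * ?s"
    by (subst (asm) mult_left_cancel) simp_all
  moreover have "?d \<noteq> 0"
  proof -
    have "fps_nth ?d 0 \<noteq> 0"
      by (simp add: sqrt_1_4x_nth_0 fps_numeral_fps_const)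
    then show ?thesis by (metis fps_zero_nth)
  qed
  ultimately show "b_gf 1 1 = (?X ^ 2 + ?X ^ 2 * ?s) / ?d"
    by (metis nonzero_mult_div_cancel_right)
next
  show "\<forall>n\<ge>1. card (inv_avoiding n {[1,2,0], [1,0,2]}) =
          1 + (\<Sum>i=1..n-1. (2 * i) choose (i - 1))"
  proof (intro allI impI)
    fix n :: nat assume "n \<ge> 1"
    then obtain k where k: "n = Suc k" by (cases n) auto
    have "real (card (inv_avoiding n {[1,2,0], [1,0,2]})) = fps_nth (ramp_gf 0) n"
      unfolding insert_commute[of "[1,2,0]"] inv_avoiding_eq_bounded_words
      by (simp add: ramp_gf_def)
    also have "\<dots> = (\<Sum>i\<le>n. fps_nth (1 + fps_X * shifted_binomial_gf) i)"
      unfolding ramp_gf_0_binomial by (subst mult.commute) (simp add: fps_mult_nth atLeast0AtMost)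
    also have "\<dots> = 1 + (\<Sum>i\<le>k. fps_nth shifted_binomial_gf i)"
      unfolding k sum.atMost_Suc_shift by simp
    also have "(\<Sum>i\<le>k. fps_nth shifted_binomial_gf i) = (\<Sum>i=1..k. real ((2 * i) choose (i - 1)))"
      by (rule sum.mono_neutral_cong_right) (auto simp: shifted_binomial_gf_def)
    finally have "real (card (inv_avoiding n {[1,2,0], [1,0,2]})) =
        real (1 + (\<Sum>i=1..n-1. (2 * i) choose (i - 1)))"
      using k by simp
    then show "card (inv_avoiding n {[1,2,0], [1,0,2]}) =
        1 + (\<Sum>i=1..n-1. (2 * i) choose (i - 1))"
      by (simp only: of_nat_eq_iff)
  qed
qed

end
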